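(* Let $\mathbb{T}$ be a time scale, $\alpha\in\,]0,1]$, and assume $f,g:\mathbb{T}\to\mathbb{R}$ are conformable fractional differentiable of order $\alpha$ (on $D_{\mathbb{T}}$). Then: (i) $f+g$ is conformable fractional differentiable of order $\alpha$ with $T_\alpha(f+g)=T_\alpha(f)+T_\alpha(g)$ on $D_{\mathbb{T}}$; (ii) for any $\lambda\in\mathbb{R}$, $\lambda f$ is conformable fractional differentiable of order $\alpha$ with $T_\alpha(\lambda f)=\lambda T_\alpha(f)$ on $D_{\mathbb{T}}$; (iii) if $f$ and $g$ are continuous, then $fg$ is conformable fractional differentiable of order $\alpha$ with $$T_\alpha(fg)=T_\alpha(f)\,g+(f\circ\sigma)\,T_\alpha(g)=T_\alpha(f)\,(g\circ\sigma)+f\,T_\alpha(g)\quad\text{on } D_{\mathbb{T}};$$ (iv) if $f$ is continuous, then $1/f$ is conformable fractional differentiable of order $\alpha$ with $$T_\alpha\left(\frac1f\right)=-\frac{T_\alpha(f)}{f\,(f\circ\sigma)}$$ at all points $t\in D_{\mathbb{T}}$ for which $f(t)f(\sigma(t))\neq0$; (v) if $f$ and $g$ are continuous, then $f/g$ is conformable fractional differentiable of order $\alpha$ with $$T_\alpha\left(\frac fg\right)=\frac{T_\alpha(f)\,g-f\,T_\alpha(g)}{g\,(g\circ\sigma)}$$ at all points $t\in D_{\mathbb{T}}$ for which $g(t)g(\sigma(t))\neq0$.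
   Context: A time scale $\mathbb{T}$ is a nonempty closed subset of $\mathbb{R}$. The forward jump is $\sigma(t)=\inf\{s\in\mathbb{T}:s>t\}$ (with $\inf\emptyset=\sup\mathbb{T}$). $\mathbb{T}^{\kappa}$ is $\mathbb{T}$ with its maximum removed if $\mathbb{T}$ has a maximum that is left-scattered (isolated from the left), and $\mathbb{T}^{\kappa}=\mathbb{T}$ otherwise. Conformable fractional derivative: for $\alpha\in\,]0,1]$, $f:\mathbb{T}\to\mathbb{R}$ and $t\in\mathbb{T}^{\kappa}$ with $t>0$, $T_\alpha(f)(t)$ is the number (provided it exists) such that for every $\epsilon>0$ there is $\delta>0$ with $$\bigl|[f(\sigma(t))-f(s)]\,t^{1-\alpha}-T_\alpha(f)(t)[\sigma(t)-s]\bigr|\le\epsilon|\sigma(t)-s|$$ for all $s\in\,]t-\delta,t+\delta[\,\cap\mathbb{T}$. At $0$ one sets $T_\alpha(f)(0)=\lim_{t\to0^+,\,t\in\mathbb{T}}T_\alpha(f)(t)$ (provided the limit exists and is finite; this presupposes that $T_\alpha(f)(t)$ exists for all small positive $t\in\mathbb{T}$). $D_{\mathbb{T}}$ denotes the set of points where this definition makes sense: all $t\in\mathbb{T}^{\kappa}$ with $t>0$, together with $t=0$ if $0\in\mathbb{T}$ and $0$ is an accumulation point of $\mathbb{T}\cap(0,\infty)$. "$f$ is conformable fractional differentiable of order $\alpha$" means $T_\alpha(f)(t)$ exists for all $t\in D_{\mathbb{T}}$. The functions $1/f$ and $f/g$ are considered where their denominators do not vanish; in (iv) and (v) the definition of $T_\alpha$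 at $t$ is applied to them with $s$ restricted to a neighborhood of $t$ on which the denominator is nonzero. *)

theory Defs
  imports "HOL-Analysis.Analysis"
begin

definition time_scale :: "real set \<Rightarrow> bool" where
  "time_scale T \<longleftrightarrow> T \<noteq> {} \<and> closed T"

definition forward_jump :: "real set \<Rightarrow> real \<Rightarrow> real" where
  "forward_jump T t = (if {s \<in> T. s > t} = {} then Sup T else Inf {s \<in> T. s > t})"

(* In a one-point time scale the only point counts as left-scattered, so T^kappa is empty. *)
definition left_scattered :: "real set \<Rightarrow> real \<Rightarrow> bool" where
  "left_scattered T t \<longleftrightarrow> \<not> t islimpt (T \<inter> {..<t})"

definition ts_kappa :: "real set \<Rightarrow> real set" where
  "ts_kappa T = T - {m \<in> T. (\<forall>s\<in>T. s \<le> m) \<and> left_scattered T m}"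

(* Functions T -> real are modelled by total functions; since forward_jump T t lies in T for t in T,
   only values on T enter. Moreover only the values at forward_jump T t and arbitrarily close to t
   matter, because delta may be shrunk. So for 1/f and f/g the value of HOL's division
   at zeros of the denominator plays no role at points near which the denominator does not vanish. *)
definition has_conformable_deriv_pos ::
    "real set \<Rightarrow> real \<Rightarrow> (real \<Rightarrow> real) \<Rightarrow> real \<Rightarrow> real \<Rightarrow> bool" where
  "has_conformable_deriv_pos T \<alpha> f t L \<longleftrightarrow>
     (\<forall>\<epsilon>>0. \<exists>\<delta>>0. \<forall>s \<in> {t - \<delta><..<t + \<delta>} \<inter> T.
        \<bar>(f (forward_jump T t) - f s) * t powr (1 - \<alpha>) - L * (forward_jump T t - s)\<bar>
          \<le> \<epsilon> * \<bar>forward_jump T t - s\<bar>)"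

definition has_conformable_deriv_zero ::
    "real set \<Rightarrow> real \<Rightarrow> (real \<Rightarrow> real) \<Rightarrow> real \<Rightarrow> bool" where
  "has_conformable_deriv_zero T \<alpha> f L \<longleftrightarrow>
     (\<forall>\<^sub>F t in at 0 within (T \<inter> {0<..}). \<exists>d. has_conformable_deriv_pos T \<alpha> f t d) \<and>
     ((\<lambda>t. THE d. has_conformable_deriv_pos T \<alpha> f t d) \<longlongrightarrow> L) (at 0 within (T \<inter> {0<..}))"

definition conformable_domain :: "real set \<Rightarrow> real set" where
  "conformable_domain T =
     {t \<in> ts_kappa T. t > 0} \<union> {t. t = 0 \<and> 0 \<in> T \<and> 0 islimpt (T \<inter> {0<..})}"

(* Meaningful for t in conformable_domain T, where L is unique. *)
definition has_conformable_deriv ::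
    "real set \<Rightarrow> real \<Rightarrow> (real \<Rightarrow> real) \<Rightarrow> real \<Rightarrow> real \<Rightarrow> bool" where
  "has_conformable_deriv T \<alpha> f t L \<longleftrightarrow>
     (if t = 0 then has_conformable_deriv_zero T \<alpha> f L else has_conformable_deriv_pos T \<alpha> f t L)"

definition conformable_deriv :: "real set \<Rightarrow> real \<Rightarrow> (real \<Rightarrow> real) \<Rightarrow> real \<Rightarrow> real" where
  "conformable_deriv T \<alpha> f t = (THE L. has_conformable_deriv T \<alpha> f t L)"

definition conformable_differentiable_at ::
    "real set \<Rightarrow> real \<Rightarrow> (real \<Rightarrow> real) \<Rightarrow> real \<Rightarrow> bool" where
  "conformable_differentiable_at T \<alpha> f t \<longleftrightarrow> (\<exists>L. has_conformable_deriv T \<alpha> f t L)"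

definition conformable_differentiable :: "real set \<Rightarrow> real \<Rightarrow> (real \<Rightarrow> real) \<Rightarrow> bool" where
  "conformable_differentiable T \<alpha> f \<longleftrightarrow>
     (\<forall>t \<in> conformable_domain T. conformable_differentiable_at T \<alpha> f t)"

end

theory Submission
  imports Defs
begin

text \<open>
  Divided by \<open>\<bar>\<sigma>(t) - s\<bar>\<close>, the estimate defining \<open>T\<^sub>\<alpha>(f)(t)\<close> says in Caratheodory's manner that
  \<open>[f(\<sigma>(t)) - f(s)] t\<^sup>1\<^sup>-\<^sup>\<alpha> = \<phi>(s) (\<sigma>(t) - s)\<close> for a slope function \<open>\<phi>\<close> that is continuous at
  \<open>t\<close> along \<open>T\<close> and has the value \<open>T\<^sub>\<alpha>(f)(t)\<close> there (\<open>caratheodory_slope_exists\<close>,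
  \<open>has_conformable_deriv_posI\<close>). In this form right-scattered and right-dense points need no
  separate treatment, and each rule at \<open>t > 0\<close> is an algebraic identity between increments,
  whose slope function is built from those of \<open>f\<close> and \<open>g\<close> and, for products and quotients,
  from \<open>f\<close> and \<open>g\<close> themselves; this is where their continuity enters. The rule for \<open>1/f\<close> is the
  quotient rule with a constant numerator.

  Points of \<open>T\<close> close to a right accumulation point \<open>0\<close> lie below another point of \<open>T\<close>, so
  derivatives are unique there and the derivative at \<open>0\<close> is the limit of any choice of
  derivatives at the points \<open>t > 0\<close> (\<open>has_conformable_deriv_zero_iff\<close>). The rules at \<open>0\<close> are
  then limits of the rules at \<open>t > 0\<close>. The limits of the terms \<open>f(\<sigma>(t))\<close> are found from
  \<open>\<sigma>(t) \<rightarrow> 0 = \<sigma>(0)\<close>. This last equation also makes the two forms of the product rule agree at \<open>0\<close>.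
  Uniqueness on the whole domain finally turns the rules into equations between values of
  \<open>T\<^sub>\<alpha>\<close>.
\<close>

section \<open>Forward jumps\<close>

lemma forward_jump_eq_Inf:
  assumes "u \<in> T" "t < u"
  shows "forward_jump T t = Inf {s \<in> T. s > t}"
  using assms by (auto simp: forward_jump_def)

lemma forward_jump_le:
  assumes "u \<in> T" "t < u"
  shows "forward_jump T t \<le> u"
  unfolding forward_jump_eq_Inf[OF assms]
  by (rule cInf_lower) (use assms in \<open>auto intro: bdd_belowI[of _ t]\<close>)

lemma forward_jump_ge:
  assumes "u \<in> T" "t < u"
  shows "t \<le> forward_jump T t"
  unfolding forward_jump_eq_Inf[OF assms]
  by (rule cInf_greatest) (use assms in auto)

lemma forward_jump_in_time_scale:
  assumes "time_scale T" "u \<in> T" "t < u"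
  shows "forward_jump T t \<in> T"
proof -
  have "Inf {s \<in> T. s > t} \<in> closure {s \<in> T. s > t}"
    by (rule closure_contains_Inf) (use assms in \<open>auto intro: bdd_belowI[of _ t]\<close>)
  also have "\<dots> \<subseteq> T"
    by (rule closure_minimal) (use assms in \<open>auto simp: time_scale_def\<close>)
  finally show ?thesis
    using forward_jump_eq_Inf[OF assms(2,3)] by simp
qed

text \<open>
  Uniqueness of the derivative at \<open>t\<close> rests on this dichotomy: the increment \<open>\<sigma>(t) - s\<close> is
  nonzero at \<open>s = t\<close> or at points \<open>s\<close> arbitrarily close to \<open>t\<close>. Removing a left-scattered
  maximum from \<open>T\<close> is what excludes the remaining case.
\<close>

lemma islimpt_if_forward_jump_eq:
  assumes "t \<in> ts_kappa T" "forward_jump T t = t"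
  shows "t islimpt T"
proof (cases "\<exists>u\<in>T. t < u")
  case True
  then obtain u where u: "u \<in> T" "t < u" by blast
  show ?thesis
    unfolding islimpt_approachable
  proof (intro allI impI)
    fix e :: real assume "e > 0"
    moreover have "Inf {s \<in> T. s > t} = t"
      using assms(2) forward_jump_eq_Inf[OF u] by simp
    ultimately have "Inf {s \<in> T. s > t} < t + e" by simp
    moreover have "{s \<in> T. s > t} \<noteq> {}" using u by blast
    ultimately obtain s where "s \<in> {s \<in> T. s > t}" "s < t + e"
      by (metis cInf_lessD)
    then show "\<exists>s\<in>T. s \<noteq> t \<and> dist s t < e"
      by (auto simp: dist_real_def intro!: bexI[of _ s])
  qed
next
  case False
  then have "t islimpt (T \<inter> {..<t})"
    using assms(1) by (auto simp: ts_kappa_def left_scattered_def not_less)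
  then show ?thesis by (rule islimpt_subset) simp
qed

section \<open>Slope functions\<close>

lemma caratheodory_slope_exists:
  assumes "has_conformable_deriv_pos T \<alpha> f t L" "t \<in> T"
  obtains \<phi> where "\<phi> t = L" "continuous (at t within T) \<phi>"
    "\<And>s. (f (forward_jump T t) - f s) * t powr (1 - \<alpha>) = \<phi> s * (forward_jump T t - s)"
proof -
  define \<sigma> where "\<sigma> = forward_jump T t"
  define \<phi> where "\<phi> s = (if s = \<sigma> then L else (f \<sigma> - f s) * t powr (1 - \<alpha>) / (\<sigma> - s))" for s
  have slope: "(f \<sigma> - f s) * t powr (1 - \<alpha>) = \<phi> s * (\<sigma> - s)" for s
    by (simp add: \<phi>_def)
  have near: "\<exists>\<delta>>0. \<forall>s\<in>{t - \<delta><..<t + \<delta>} \<inter> T. \<bar>\<phi> s - L\<bar> \<le> \<epsilon>" if "\<epsilon> > 0" for \<epsilon>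
  proof -
    obtain \<delta> where \<delta>: "\<delta> > 0"
      "\<forall>s\<in>{t - \<delta><..<t + \<delta>} \<inter> T.
         \<bar>(f \<sigma> - f s) * t powr (1 - \<alpha>) - L * (\<sigma> - s)\<bar> \<le> \<epsilon> * \<bar>\<sigma> - s\<bar>"
      using assms(1) \<open>\<epsilon> > 0\<close> unfolding has_conformable_deriv_pos_def \<sigma>_def by blast
    have "\<bar>\<phi> s - L\<bar> \<le> \<epsilon>" if s: "s \<in> {t - \<delta><..<t + \<delta>} \<inter> T" for s
    proof (cases "s = \<sigma>")
      case True
      then show ?thesis using \<open>\<epsilon> > 0\<close> by (simp add: \<phi>_def)
    next
      case False
      have "\<bar>(\<phi> s - L) * (\<sigma> - s)\<bar> \<le> \<epsilon> * \<bar>\<sigma> - s\<bar>"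
        using \<delta>(2)[rule_format, OF s] unfolding slope by (simp only: left_diff_distrib)
      then show ?thesis using False by (simp add: abs_mult)
    qed
    then show ?thesis using \<delta>(1) by blast
  qed
  \<comment> \<open>The estimate also holds at \<open>s = t\<close>, for every \<open>\<epsilon>\<close>; this fixes the value of the slope at a
    right-scattered point.\<close>
  have "\<bar>\<phi> t - L\<bar> \<le> \<epsilon>" if "\<epsilon> > 0" for \<epsilon>
    using near[OF that] assms(2) by force
  then have \<phi>t: "\<phi> t = L"
    using field_le_epsilon[of "\<bar>\<phi> t - L\<bar>" 0] by simp
  have "(\<phi> \<longlongrightarrow> \<phi> t) (at t within T)"
  proof (rule tendstoI)
    fix e :: real assume "e > 0"
    then obtain \<delta> where "\<delta> > 0" "\<forall>s\<in>{t - \<delta><..<t + \<delta>} \<inter> T. \<bar>\<phi> s - L\<bar> \<le> e / 2"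
      using near[of "e / 2"] by auto
    then show "\<forall>\<^sub>F s in at t within T. dist (\<phi> s) (\<phi> t) < e"
      unfolding eventually_at \<phi>t using \<open>e > 0\<close>
      by (intro exI[of _ \<delta>]) (force simp: dist_real_def)
  qed
  then show ?thesis
    using that[of \<phi>] \<phi>t slope by (simp add: continuous_within \<sigma>_def)
qed

lemma has_conformable_deriv_posI:
  assumes "\<phi> t = L" "continuous (at t within T) \<phi>"
    and at_t: "(f (forward_jump T t) - f t) * t powr (1 - \<alpha>) = \<phi> t * (forward_jump T t - t)"
    and near: "\<forall>\<^sub>F s in at t within T.
      (f (forward_jump T t) - f s) * t powr (1 - \<alpha>) = \<phi> s * (forward_jump T t - s)"
  shows "has_conformable_deriv_pos T \<alpha> f t L"
  unfolding has_conformable_deriv_pos_def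
proof (intro allI impI)
  fix \<epsilon> :: real assume "\<epsilon> > 0"
  have "\<forall>\<^sub>F s in at t within T. dist (\<phi> s) L < \<epsilon>"
    using assms(1,2) \<open>\<epsilon> > 0\<close> by (auto simp: continuous_within intro: tendstoD)
  with near have "\<forall>\<^sub>F s in at t within T. dist (\<phi> s) L < \<epsilon> \<and>
      (f (forward_jump T t) - f s) * t powr (1 - \<alpha>) = \<phi> s * (forward_jump T t - s)"
    by eventually_elim simp
  then obtain \<delta> where \<delta>: "\<delta> > 0" "\<forall>s\<in>T. s \<noteq> t \<and> dist s t < \<delta> \<longrightarrow> dist (\<phi> s) L < \<epsilon> \<and>
      (f (forward_jump T t) - f s) * t powr (1 - \<alpha>) = \<phi> s * (forward_jump T t - s)"
    unfolding eventually_at by blast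
  have "\<bar>(f (forward_jump T t) - f s) * t powr (1 - \<alpha>) - L * (forward_jump T t - s)\<bar>
        \<le> \<epsilon> * \<bar>forward_jump T t - s\<bar>" if s: "s \<in> {t - \<delta><..<t + \<delta>} \<inter> T" for s
  proof -
    have "dist (\<phi> s) L < \<epsilon>" and
      eq: "(f (forward_jump T t) - f s) * t powr (1 - \<alpha>) = \<phi> s * (forward_jump T t - s)"
      using \<delta>(2) s \<open>\<epsilon> > 0\<close> assms(1) at_t by (cases "s = t"; force simp: dist_real_def)+
    then have "\<bar>\<phi> s - L\<bar> * \<bar>forward_jump T t - s\<bar> \<le> \<epsilon> * \<bar>forward_jump T t - s\<bar>"
      by (intro mult_right_mono) (auto simp: dist_real_def)
    then show ?thesis
      unfolding eq by (simp add: abs_mult flip: left_diff_distrib)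
  qed
  then show "\<exists>\<delta>>0. \<forall>s\<in>{t - \<delta><..<t + \<delta>} \<inter> T.
      \<bar>(f (forward_jump T t) - f s) * t powr (1 - \<alpha>) - L * (forward_jump T t - s)\<bar>
        \<le> \<epsilon> * \<bar>forward_jump T t - s\<bar>"
    using \<delta>(1) by blast
qed

lemma has_conformable_deriv_pos_unique:
  assumes "t \<in> ts_kappa T"
    and "has_conformable_deriv_pos T \<alpha> f t L" "has_conformable_deriv_pos T \<alpha> f t M"
  shows "L = M"
proof -
  have "t \<in> T" using assms(1) by (simp add: ts_kappa_def)
  obtain \<phi> where \<phi>: "\<phi> t = L" "continuous (at t within T) \<phi>"
    "\<And>s. (f (forward_jump T t) - f s) * t powr (1 - \<alpha>) = \<phi> s * (forward_jump T t - s)"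
    using caratheodory_slope_exists[OF assms(2) \<open>t \<in> T\<close>] by metis
  obtain \<psi> where \<psi>: "\<psi> t = M" "continuous (at t within T) \<psi>"
    "\<And>s. (f (forward_jump T t) - f s) * t powr (1 - \<alpha>) = \<psi> s * (forward_jump T t - s)"
    using caratheodory_slope_exists[OF assms(3) \<open>t \<in> T\<close>] by metis
  have eq: "\<phi> s = \<psi> s" if "s \<noteq> forward_jump T t" for s
    using \<phi>(3)[of s] \<psi>(3)[of s] that by simp
  show ?thesis
  proof (cases "forward_jump T t = t")
    case False
    then show ?thesis using eq[of t] \<phi>(1) \<psi>(1) by auto
  next
    case True
    then have "at t within T \<noteq> bot"
      using islimpt_if_forward_jump_eq[OF assms(1)] by (simp add: trivial_limit_within)
    moreover have "(\<phi> \<longlongrightarrow> L) (at t within T)"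
      using \<phi>(1,2) by (simp add: continuous_within)
    moreover have "\<forall>\<^sub>F s in at t within T. \<phi> s = \<psi> s"
      using eq True by (simp add: eventually_at_filter)
    then have "(\<phi> \<longlongrightarrow> M) (at t within T)"
      using \<psi>(1,2) by (simp only: tendsto_cong continuous_within)
    ultimately show ?thesis by (rule tendsto_unique)
  qed
qed

section \<open>Differentiation rules at positive points\<close>

lemma has_conformable_deriv_pos_const:
  "has_conformable_deriv_pos T \<alpha> (\<lambda>s. c) t 0"
  by (auto simp: has_conformable_deriv_pos_def intro: exI[of _ 1])

lemma has_conformable_deriv_pos_add:
  assumes "t \<in> T" "has_conformable_deriv_pos T \<alpha> f t F" "has_conformable_deriv_pos T \<alpha> g t G"
  shows "has_conformable_deriv_pos T \<alpha> (\<lambda>s. f s + g s) t (F + G)"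
proof -
  obtain \<phi> where \<phi>: "\<phi> t = F" "continuous (at t within T) \<phi>"
    "\<And>s. (f (forward_jump T t) - f s) * t powr (1 - \<alpha>) = \<phi> s * (forward_jump T t - s)"
    using caratheodory_slope_exists[OF assms(2,1)] by metis
  obtain \<psi> where \<psi>: "\<psi> t = G" "continuous (at t within T) \<psi>"
    "\<And>s. (g (forward_jump T t) - g s) * t powr (1 - \<alpha>) = \<psi> s * (forward_jump T t - s)"
    using caratheodory_slope_exists[OF assms(3,1)] by metis
  have "(f (forward_jump T t) + g (forward_jump T t) - (f s + g s)) * t powr (1 - \<alpha>)
      = (\<phi> s + \<psi> s) * (forward_jump T t - s)" for s
    using \<phi>(3)[of s] \<psi>(3)[of s] by algebra
  then show ?thesis
    using \<phi> \<psi> by (intro has_conformable_deriv_posI[where \<phi> = "\<lambda>s. \<phi> s + \<psi> s"])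
      (auto intro!: continuous_intros)
qed

lemma has_conformable_deriv_pos_mult:
  assumes "t \<in> T" "has_conformable_deriv_pos T \<alpha> f t F" "has_conformable_deriv_pos T \<alpha> g t G"
    and "continuous (at t within T) f"
  shows "has_conformable_deriv_pos T \<alpha> (\<lambda>s. f s * g s) t (F * g (forward_jump T t) + f t * G)"
proof -
  obtain \<phi> where \<phi>: "\<phi> t = F" "continuous (at t within T) \<phi>"
    "\<And>s. (f (forward_jump T t) - f s) * t powr (1 - \<alpha>) = \<phi> s * (forward_jump T t - s)"
    using caratheodory_slope_exists[OF assms(2,1)] by metis
  obtain \<psi> where \<psi>: "\<psi> t = G" "continuous (at t within T) \<psi>"
    "\<And>s. (g (forward_jump T t) - g s) * t powr (1 - \<alpha>) = \<psi> s * (forward_jump T t - s)"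
    using caratheodory_slope_exists[OF assms(3,1)] by metis
  have "(f (forward_jump T t) * g (forward_jump T t) - f s * g s) * t powr (1 - \<alpha>)
      = (\<phi> s * g (forward_jump T t) + f s * \<psi> s) * (forward_jump T t - s)" for s
    using \<phi>(3)[of s] \<psi>(3)[of s] by algebra
  then show ?thesis
    using \<phi> \<psi> assms(4)
    by (intro has_conformable_deriv_posI
        [where \<phi> = "\<lambda>s. \<phi> s * g (forward_jump T t) + f s * \<psi> s"])
      (auto intro!: continuous_intros)
qed

lemma has_conformable_deriv_pos_cmult:
  assumes "t \<in> T" "has_conformable_deriv_pos T \<alpha> f t F"
  shows "has_conformable_deriv_pos T \<alpha> (\<lambda>s. c * f s) t (c * F)"
  using has_conformable_deriv_pos_mult[OF assms(1) has_conformable_deriv_pos_const assms(2)]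
  by simp

lemma has_conformable_deriv_pos_divide:
  assumes "t \<in> T" "has_conformable_deriv_pos T \<alpha> f t F" "has_conformable_deriv_pos T \<alpha> g t G"
    and cont: "continuous (at t within T) f" "continuous (at t within T) g"
    and nz: "g t \<noteq> 0" "g (forward_jump T t) \<noteq> 0"
  shows "has_conformable_deriv_pos T \<alpha> (\<lambda>s. f s / g s) t
    ((F * g t - f t * G) / (g t * g (forward_jump T t)))"
proof -
  obtain \<phi> where \<phi>: "\<phi> t = F" "continuous (at t within T) \<phi>"
    "\<And>s. (f (forward_jump T t) - f s) * t powr (1 - \<alpha>) = \<phi> s * (forward_jump T t - s)"
    using caratheodory_slope_exists[OF assms(2,1)] by metis
  obtain \<psi> where \<psi>: "\<psi> t = G" "continuous (at t within T) \<psi>"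
    "\<And>s. (g (forward_jump T t) - g s) * t powr (1 - \<alpha>) = \<psi> s * (forward_jump T t - s)"
    using caratheodory_slope_exists[OF assms(3,1)] by metis
  define \<omega> where "\<omega> s = (\<phi> s * g s - f s * \<psi> s) / (g s * g (forward_jump T t))" for s
  have slope: "(f (forward_jump T t) / g (forward_jump T t) - f s / g s) * t powr (1 - \<alpha>)
      = \<omega> s * (forward_jump T t - s)" if "g s \<noteq> 0" for s
  proof -
    have "(f (forward_jump T t) * g s - f s * g (forward_jump T t)) * t powr (1 - \<alpha>)
        = (\<phi> s * g s - f s * \<psi> s) * (forward_jump T t - s)"
      using \<phi>(3)[of s] \<psi>(3)[of s] by algebra
    then show ?thesis
      using that nz(2) by (simp add: \<omega>_def diff_frac_eq mult.commute)
  qed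
  have "\<forall>\<^sub>F s in at t within T. g s \<noteq> 0"
    using cont(2) nz(1) by (auto simp: continuous_within intro: tendsto_imp_eventually_ne)
  then have "\<forall>\<^sub>F s in at t within T.
      (f (forward_jump T t) / g (forward_jump T t) - f s / g s) * t powr (1 - \<alpha>)
      = \<omega> s * (forward_jump T t - s)"
    by eventually_elim (rule slope)
  moreover have "continuous (at t within T) \<omega>"
    unfolding \<omega>_def using \<phi>(2) \<psi>(2) cont nz by (intro continuous_intros) auto
  moreover have "\<omega> t = (F * g t - f t * G) / (g t * g (forward_jump T t))"
    by (simp add: \<omega>_def \<phi>(1) \<psi>(1))
  ultimately show ?thesis
    using slope[OF nz(1)] by (intro has_conformable_deriv_posI[where \<phi> = \<omega>]) auto
qed

section \<open>Differentiation rules at zero\<close>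

text \<open>
  A point of \<open>T\<close> that lies below another one is not the maximum, so it belongs to \<open>T\<^sup>\<kappa>\<close> and its
  forward jump stays in \<open>T\<close>. Near a right accumulation point this covers all points.
\<close>

lemma eventually_ts_kappa_at_zero:
  assumes "time_scale T" "0 islimpt (T \<inter> {0<..})"
  shows "\<forall>\<^sub>F t in at 0 within (T \<inter> {0<..}). t \<in> ts_kappa T \<and> t > 0 \<and> forward_jump T t \<in> T"
proof -
  obtain u where u: "u \<in> T" "u > 0"
    using assms(2) unfolding islimpt_approachable by (metis IntD1 IntD2 greaterThan_iff zero_less_one)
  have "t \<in> ts_kappa T \<and> t > 0 \<and> forward_jump T t \<in> T" if "t \<in> T \<inter> {0<..}" "dist t 0 < u" for t
  proof -
    have "t < u" "t \<in> T" "t > 0" using that by (auto simp: dist_real_def)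
    then show ?thesis
      using u forward_jump_in_time_scale[OF assms(1) u(1)] by (auto simp: ts_kappa_def not_le)
  qed
  then show ?thesis
    unfolding eventually_at using u(2) by blast
qed

lemma forward_jump_tendsto_zero:
  assumes "0 islimpt (T \<inter> {0<..})"
  shows "(forward_jump T \<longlongrightarrow> 0) (at 0 within (T \<inter> {0<..}))"
proof (rule tendstoI)
  fix e :: real assume "e > 0"
  then obtain u where u: "u \<in> T" "u > 0" "u < e"
    using assms unfolding islimpt_approachable by (force simp: dist_real_def)
  have "dist (forward_jump T t) 0 < e" if "t \<in> T \<inter> {0<..}" "dist t 0 < u" for t
  proof -
    have "t < u" "t > 0" using that by (auto simp: dist_real_def)
    then show ?thesis
      using forward_jump_le[OF u(1)] forward_jump_ge[OF u(1)] u by (force simp: dist_real_def)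
  qed
  then show "\<forall>\<^sub>F t in at 0 within (T \<inter> {0<..}). dist (forward_jump T t) 0 < e"
    unfolding eventually_at using u(2) by blast
qed

lemma forward_jump_zero:
  assumes "0 islimpt (T \<inter> {0<..})"
  shows "forward_jump T 0 = 0"
proof (rule antisym)
  show "forward_jump T 0 \<le> 0"
  proof (rule field_le_epsilon)
    fix e :: real assume "e > 0"
    then obtain u where "u \<in> T" "u > 0" "u < e"
      using assms unfolding islimpt_approachable by (force simp: dist_real_def)
    then show "forward_jump T 0 \<le> 0 + e"
      using forward_jump_le[of u T 0] by simp
  qed
  show "0 \<le> forward_jump T 0"
    using assms forward_jump_ge[of _ T 0] unfolding islimpt_approachable
    by (metis IntD1 IntD2 greaterThan_iff zero_less_one)
qed

lemma continuous_on_tendsto_forward_jump_zero: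
  assumes "time_scale T" "0 islimpt (T \<inter> {0<..})" "0 \<in> T" "continuous_on T f"
  shows "((\<lambda>t. f (forward_jump T t)) \<longlongrightarrow> f 0) (at 0 within (T \<inter> {0<..}))"
proof (rule continuous_on_tendsto_compose[OF assms(4)])
  show "\<forall>\<^sub>F t in at 0 within (T \<inter> {0<..}). forward_jump T t \<in> T"
    using eventually_ts_kappa_at_zero[OF assms(1,2)] by eventually_elim simp
qed (use assms forward_jump_tendsto_zero in auto)

lemma continuous_on_tendsto_zero:
  assumes "0 \<in> T" "continuous_on T f"
  shows "(f \<longlongrightarrow> f 0) (at 0 within (T \<inter> {0<..}))"
  using assms by (auto simp: continuous_on_def intro: tendsto_within_subset)

text \<open>Uniqueness near \<open>0\<close> allows an arbitrary choice \<open>d\<close> in place of the definite description.\<close>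

lemma has_conformable_deriv_zero_iff:
  assumes "time_scale T" "0 islimpt (T \<inter> {0<..})"
  shows "has_conformable_deriv_zero T \<alpha> f L \<longleftrightarrow>
    (\<exists>d. (\<forall>\<^sub>F t in at 0 within (T \<inter> {0<..}). has_conformable_deriv_pos T \<alpha> f t (d t)) \<and>
         (d \<longlongrightarrow> L) (at 0 within (T \<inter> {0<..})))"
    (is "_ \<longleftrightarrow> (\<exists>d. ?choice d)")
proof
  note kappa = eventually_ts_kappa_at_zero[OF assms]
  {
    assume L: "has_conformable_deriv_zero T \<alpha> f L"
    then have "\<forall>\<^sub>F t in at 0 within (T \<inter> {0<..}). \<exists>d. has_conformable_deriv_pos T \<alpha> f t d"
      by (simp add: has_conformable_deriv_zero_def)
    with kappa have "\<forall>\<^sub>F t in at 0 within (T \<inter> {0<..}).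
        has_conformable_deriv_pos T \<alpha> f t (THE d. has_conformable_deriv_pos T \<alpha> f t d)"
      by eventually_elim (metis has_conformable_deriv_pos_unique theI)
    then show "\<exists>d. ?choice d"
      using L unfolding has_conformable_deriv_zero_def
      by (intro exI[of _ "\<lambda>t. THE d. has_conformable_deriv_pos T \<alpha> f t d"]) simp
  next
    assume "\<exists>d. ?choice d"
    then obtain d where ev: "\<forall>\<^sub>F t in at 0 within (T \<inter> {0<..}). has_conformable_deriv_pos T \<alpha> f t (d t)"
      and lim: "(d \<longlongrightarrow> L) (at 0 within (T \<inter> {0<..}))" by blast
    have "\<forall>\<^sub>F t in at 0 within (T \<inter> {0<..}). \<exists>d. has_conformable_deriv_pos T \<alpha> f t d"
      using ev by eventually_elim blast
    moreover have "\<forall>\<^sub>F t in at 0 within (T \<inter> {0<..}).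
        d t = (THE d. has_conformable_deriv_pos T \<alpha> f t d)"
      using ev kappa by eventually_elim (metis has_conformable_deriv_pos_unique the_equality)
    ultimately show "has_conformable_deriv_zero T \<alpha> f L"
      unfolding has_conformable_deriv_zero_def using lim by (simp add: tendsto_cong)
  }
qed

text \<open>
  The passage to the limit shared by all rules: a rule at \<open>t > 0\<close> with value \<open>R t a b\<close> yields
  the rule at \<open>0\<close>, whose value is the limit of \<open>R t a b\<close> as \<open>t\<close>, \<open>a\<close> and \<open>b\<close> tend to \<open>0\<close>, \<open>F\<close> and \<open>G\<close>.
\<close>

lemma has_conformable_deriv_zero_combine:
  assumes "time_scale T" "0 islimpt (T \<inter> {0<..})"
    and "has_conformable_deriv_zero T \<alpha> f F" "has_conformable_deriv_zero T \<alpha> g G"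
    and rule: "\<forall>\<^sub>F t in at 0 within (T \<inter> {0<..}). \<forall>a b.
      has_conformable_deriv_pos T \<alpha> f t a \<longrightarrow> has_conformable_deriv_pos T \<alpha> g t b \<longrightarrow>
      has_conformable_deriv_pos T \<alpha> h t (R t a b)"
    and lim: "\<And>a b. (a \<longlongrightarrow> F) (at 0 within (T \<inter> {0<..})) \<Longrightarrow>
      (b \<longlongrightarrow> G) (at 0 within (T \<inter> {0<..})) \<Longrightarrow>
      ((\<lambda>t. R t (a t) (b t)) \<longlongrightarrow> L) (at 0 within (T \<inter> {0<..}))"
  shows "has_conformable_deriv_zero T \<alpha> h L"
proof -
  obtain a where a: "\<forall>\<^sub>F t in at 0 within (T \<inter> {0<..}). has_conformable_deriv_pos T \<alpha> f t (a t)"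
    "(a \<longlongrightarrow> F) (at 0 within (T \<inter> {0<..}))"
    using assms(3) unfolding has_conformable_deriv_zero_iff[OF assms(1,2)] by blast
  obtain b where b: "\<forall>\<^sub>F t in at 0 within (T \<inter> {0<..}). has_conformable_deriv_pos T \<alpha> g t (b t)"
    "(b \<longlongrightarrow> G) (at 0 within (T \<inter> {0<..}))"
    using assms(4) unfolding has_conformable_deriv_zero_iff[OF assms(1,2)] by blast
  have "\<forall>\<^sub>F t in at 0 within (T \<inter> {0<..}). has_conformable_deriv_pos T \<alpha> h t (R t (a t) (b t))"
    using a(1) b(1) rule by eventually_elim blast
  then show ?thesis
    unfolding has_conformable_deriv_zero_iff[OF assms(1,2)] using lim[OF a(2) b(2)]
    by (intro exI[of _ "\<lambda>t. R t (a t) (b t)"]) simp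
qed

lemma has_conformable_deriv_zero_add:
  assumes "time_scale T" "0 islimpt (T \<inter> {0<..})"
    and "has_conformable_deriv_zero T \<alpha> f F" "has_conformable_deriv_zero T \<alpha> g G"
  shows "has_conformable_deriv_zero T \<alpha> (\<lambda>s. f s + g s) (F + G)"
proof (rule has_conformable_deriv_zero_combine[OF assms, where R = "\<lambda>t a b. a + b"])
  show "\<forall>\<^sub>F t in at 0 within (T \<inter> {0<..}). \<forall>a b.
      has_conformable_deriv_pos T \<alpha> f t a \<longrightarrow> has_conformable_deriv_pos T \<alpha> g t b \<longrightarrow>
      has_conformable_deriv_pos T \<alpha> (\<lambda>s. f s + g s) t (a + b)"
    using eventually_ts_kappa_at_zero[OF assms(1,2)]
    by eventually_elim (auto simp: ts_kappa_def intro: has_conformable_deriv_pos_add)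
qed (intro tendsto_intros)

lemma has_conformable_deriv_zero_cmult:
  assumes "time_scale T" "0 islimpt (T \<inter> {0<..})"
    and "has_conformable_deriv_zero T \<alpha> f F"
  shows "has_conformable_deriv_zero T \<alpha> (\<lambda>s. c * f s) (c * F)"
proof (rule has_conformable_deriv_zero_combine[OF assms assms(3), where R = "\<lambda>t a b. c * a"])
  show "\<forall>\<^sub>F t in at 0 within (T \<inter> {0<..}). \<forall>a b.
      has_conformable_deriv_pos T \<alpha> f t a \<longrightarrow> has_conformable_deriv_pos T \<alpha> f t b \<longrightarrow>
      has_conformable_deriv_pos T \<alpha> (\<lambda>s. c * f s) t (c * a)"
    using eventually_ts_kappa_at_zero[OF assms(1,2)]
    by eventually_elim (auto simp: ts_kappa_def intro: has_conformable_deriv_pos_cmult)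
qed (intro tendsto_intros)

lemma has_conformable_deriv_zero_mult:
  assumes "time_scale T" "0 islimpt (T \<inter> {0<..})"
    and "has_conformable_deriv_zero T \<alpha> f F" "has_conformable_deriv_zero T \<alpha> g G"
    and "0 \<in> T" "continuous_on T f" "continuous_on T g"
  shows "has_conformable_deriv_zero T \<alpha> (\<lambda>s. f s * g s) (F * g 0 + f 0 * G)"
proof (rule has_conformable_deriv_zero_combine[OF assms(1-4),
      where R = "\<lambda>t a b. a * g (forward_jump T t) + f t * b"])
  show "\<forall>\<^sub>F t in at 0 within (T \<inter> {0<..}). \<forall>a b.
      has_conformable_deriv_pos T \<alpha> f t a \<longrightarrow> has_conformable_deriv_pos T \<alpha> g t b \<longrightarrow>
      has_conformable_deriv_pos T \<alpha> (\<lambda>s. f s * g s) t (a * g (forward_jump T t) + f t * b)"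
    using eventually_ts_kappa_at_zero[OF assms(1,2)]
    by eventually_elim (use assms(6) in \<open>auto simp: ts_kappa_def continuous_on_eq_continuous_within
          intro: has_conformable_deriv_pos_mult\<close>)
qed (intro tendsto_intros continuous_on_tendsto_forward_jump_zero continuous_on_tendsto_zero assms)

lemma has_conformable_deriv_zero_divide:
  assumes "time_scale T" "0 islimpt (T \<inter> {0<..})"
    and "has_conformable_deriv_zero T \<alpha> f F" "has_conformable_deriv_zero T \<alpha> g G"
    and "0 \<in> T" "continuous_on T f" "continuous_on T g" "g 0 \<noteq> 0"
  shows "has_conformable_deriv_zero T \<alpha> (\<lambda>s. f s / g s) ((F * g 0 - f 0 * G) / (g 0 * g 0))"
proof (rule has_conformable_deriv_zero_combine[OF assms(1-4),
      where R = "\<lambda>t a b. (a * g t - f t * b) / (g t * g (forward_jump T t))"])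
  note lim_g = continuous_on_tendsto_zero[OF assms(5,7)]
    and lim_gj = continuous_on_tendsto_forward_jump_zero[OF assms(1,2,5,7)]
  show "\<forall>\<^sub>F t in at 0 within (T \<inter> {0<..}). \<forall>a b.
      has_conformable_deriv_pos T \<alpha> f t a \<longrightarrow> has_conformable_deriv_pos T \<alpha> g t b \<longrightarrow>
      has_conformable_deriv_pos T \<alpha> (\<lambda>s. f s / g s) t
        ((a * g t - f t * b) / (g t * g (forward_jump T t)))"
    using eventually_ts_kappa_at_zero[OF assms(1,2)]
      tendsto_imp_eventually_ne[OF lim_g assms(8)] tendsto_imp_eventually_ne[OF lim_gj assms(8)]
    by eventually_elim (use assms(6,7) in
        \<open>auto simp: ts_kappa_def continuous_on_eq_continuous_within
          intro!: has_conformable_deriv_pos_divide\<close>)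
  show "((\<lambda>t. (a t * g t - f t * b t) / (g t * g (forward_jump T t))) \<longlongrightarrow>
      (F * g 0 - f 0 * G) / (g 0 * g 0)) (at 0 within (T \<inter> {0<..}))"
    if "(a \<longlongrightarrow> F) (at 0 within (T \<inter> {0<..}))" "(b \<longlongrightarrow> G) (at 0 within (T \<inter> {0<..}))" for a b
    by (intro tendsto_intros that lim_g lim_gj continuous_on_tendsto_zero assms)
      (use assms(8) in simp)
qed

section \<open>Differentiation rules on the whole domain\<close>

lemma conformable_domain_cases:
  assumes "t \<in> conformable_domain T"
  obtains (pos) "t > 0" "t \<in> ts_kappa T" "t \<in> T"
    | (zero) "t = 0" "0 \<in> T" "0 islimpt (T \<inter> {0<..})" "forward_jump T 0 = 0"
  using assms forward_jump_zero by (auto simp: conformable_domain_def ts_kappa_def)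

lemma has_conformable_deriv_unique:
  assumes "t \<in> conformable_domain T"
    and "has_conformable_deriv T \<alpha> f t L" "has_conformable_deriv T \<alpha> f t M"
  shows "L = M"
  using assms(1)
proof (cases rule: conformable_domain_cases)
  case pos
  then show ?thesis
    using assms(2,3) has_conformable_deriv_pos_unique by (auto simp: has_conformable_deriv_def)
next
  case zero
  then have "at 0 within (T \<inter> {0<..}) \<noteq> bot"
    by (simp add: trivial_limit_within)
  then show ?thesis
    using assms(2,3) zero(1)
    by (auto simp: has_conformable_deriv_def has_conformable_deriv_zero_def dest: tendsto_unique)
qed

lemma conformable_deriv_eqI:
  assumes "t \<in> conformable_domain T" "has_conformable_deriv T \<alpha> f t L"
  shows "conformable_deriv T \<alpha> f t = L"
  unfolding conformable_deriv_def
  using assms has_conformable_deriv_unique by blast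

lemma has_conformable_deriv_conformable_deriv:
  assumes "conformable_differentiable T \<alpha> f" "t \<in> conformable_domain T"
  shows "has_conformable_deriv T \<alpha> f t (conformable_deriv T \<alpha> f t)"
  using assms conformable_deriv_eqI
  unfolding conformable_differentiable_def conformable_differentiable_at_def by metis

lemma has_conformable_deriv_const:
  "has_conformable_deriv T \<alpha> (\<lambda>s. c) t 0" if "time_scale T" "t \<in> conformable_domain T"
  using that(2)
proof (cases rule: conformable_domain_cases)
  case zero
  then show ?thesis
    using has_conformable_deriv_zero_iff[OF that(1)] has_conformable_deriv_pos_const
    by (auto simp: has_conformable_deriv_def intro!: exI[of _ "\<lambda>_. 0"])
qed (simp add: has_conformable_deriv_def has_conformable_deriv_pos_const)

lemma has_conformable_deriv_add:
  assumes "time_scale T" "t \<in> conformable_domain T"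
    and "has_conformable_deriv T \<alpha> f t F" "has_conformable_deriv T \<alpha> g t G"
  shows "has_conformable_deriv T \<alpha> (\<lambda>s. f s + g s) t (F + G)"
  using assms(2)
proof (cases rule: conformable_domain_cases)
  case pos
  then show ?thesis
    using assms(3,4) by (simp add: has_conformable_deriv_def has_conformable_deriv_pos_add)
next
  case zero
  then show ?thesis
    using assms(1,3,4) by (simp add: has_conformable_deriv_def has_conformable_deriv_zero_add)
qed

lemma has_conformable_deriv_cmult:
  assumes "time_scale T" "t \<in> conformable_domain T" "has_conformable_deriv T \<alpha> f t F"
  shows "has_conformable_deriv T \<alpha> (\<lambda>s. c * f s) t (c * F)"
  using assms(2)
proof (cases rule: conformable_domain_cases)
  case pos
  then show ?thesis
    using assms(3) by (simp add: has_conformable_deriv_def has_conformable_deriv_pos_cmult)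
next
  case zero
  then show ?thesis
    using assms(1,3) by (simp add: has_conformable_deriv_def has_conformable_deriv_zero_cmult)
qed

lemma has_conformable_deriv_mult:
  assumes "time_scale T" "t \<in> conformable_domain T"
    and "has_conformable_deriv T \<alpha> f t F" "has_conformable_deriv T \<alpha> g t G"
    and "continuous_on T f" "continuous_on T g"
  shows "has_conformable_deriv T \<alpha> (\<lambda>s. f s * g s) t (F * g (forward_jump T t) + f t * G)"
  using assms(2)
proof (cases rule: conformable_domain_cases)
  case pos
  then show ?thesis
    using assms(3-5) by (simp add: has_conformable_deriv_def has_conformable_deriv_pos_mult
        continuous_on_eq_continuous_within)
next
  case zero
  then show ?thesis
    using assms by (simp add: has_conformable_deriv_def has_conformable_deriv_zero_mult)
qed

lemma has_conformable_deriv_divide: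
  assumes "time_scale T" "t \<in> conformable_domain T"
    and "has_conformable_deriv T \<alpha> f t F" "has_conformable_deriv T \<alpha> g t G"
    and "continuous_on T f" "continuous_on T g"
    and "g t * g (forward_jump T t) \<noteq> 0"
  shows "has_conformable_deriv T \<alpha> (\<lambda>s. f s / g s) t
    ((F * g t - f t * G) / (g t * g (forward_jump T t)))"
  using assms(2)
proof (cases rule: conformable_domain_cases)
  case pos
  then show ?thesis
    using assms(3-7) by (simp add: has_conformable_deriv_def has_conformable_deriv_pos_divide
        continuous_on_eq_continuous_within)
next
  case zero
  then show ?thesis
    using assms by (simp add: has_conformable_deriv_def has_conformable_deriv_zero_divide)
qed

theorem theorem15:
  fixes T :: "real set" and \<alpha> :: real and f g :: "real \<Rightarrow> real"
  assumes "time_scale T"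
    and "0 < \<alpha>" and "\<alpha> \<le> 1"
    and "conformable_differentiable T \<alpha> f"
    and "conformable_differentiable T \<alpha> g"
  shows
    "(conformable_differentiable T \<alpha> (\<lambda>s. f s + g s) \<and>
      (\<forall>t \<in> conformable_domain T.
         conformable_deriv T \<alpha> (\<lambda>s. f s + g s) t
           = conformable_deriv T \<alpha> f t + conformable_deriv T \<alpha> g t)) \<and>
     (\<forall>c::real. conformable_differentiable T \<alpha> (\<lambda>s. c * f s) \<and>
      (\<forall>t \<in> conformable_domain T.
         conformable_deriv T \<alpha> (\<lambda>s. c * f s) t = c * conformable_deriv T \<alpha> f t)) \<and>
     (continuous_on T f \<and> continuous_on T g \<longrightarrow>
      conformable_differentiable T \<alpha> (\<lambda>s. f s * g s) \<and>
      (\<forall>t \<in> conformable_domain T.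
         conformable_deriv T \<alpha> (\<lambda>s. f s * g s) t
           = conformable_deriv T \<alpha> f t * g t + f (forward_jump T t) * conformable_deriv T \<alpha> g t \<and>
         conformable_deriv T \<alpha> (\<lambda>s. f s * g s) t
           = conformable_deriv T \<alpha> f t * g (forward_jump T t) + f t * conformable_deriv T \<alpha> g t)) \<and>
     (continuous_on T f \<longrightarrow>
      (\<forall>t \<in> conformable_domain T. f t * f (forward_jump T t) \<noteq> 0 \<longrightarrow>
         conformable_differentiable_at T \<alpha> (\<lambda>s. 1 / f s) t \<and>
         conformable_deriv T \<alpha> (\<lambda>s. 1 / f s) t
           = - (conformable_deriv T \<alpha> f t / (f t * f (forward_jump T t))))) \<and>
     (continuous_on T f \<and> continuous_on T g \<longrightarrow>
      (\<forall>t \<in> conformable_domain T. g t * g (forward_jump T t) \<noteq> 0 \<longrightarrow>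
         conformable_differentiable_at T \<alpha> (\<lambda>s. f s / g s) t \<and>
         conformable_deriv T \<alpha> (\<lambda>s. f s / g s) t
           = (conformable_deriv T \<alpha> f t * g t - f t * conformable_deriv T \<alpha> g t)
               / (g t * g (forward_jump T t))))"
proof -
  let ?D = "conformable_deriv T \<alpha>"
  note T = \<open>time_scale T\<close>
  note f = has_conformable_deriv_conformable_deriv[OF assms(4)]
    and g = has_conformable_deriv_conformable_deriv[OF assms(5)]
  have ex: "conformable_differentiable_at T \<alpha> h t" if "has_conformable_deriv T \<alpha> h t L" for h t L
    using that by (auto simp: conformable_differentiable_at_def)
  have add: "has_conformable_deriv T \<alpha> (\<lambda>s. f s + g s) t (?D f t + ?D g t)"
    if "t \<in> conformable_domain T" for t
    using has_conformable_deriv_add[OF T that f g] that by blast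
  have cmult: "has_conformable_deriv T \<alpha> (\<lambda>s. c * f s) t (c * ?D f t)"
    if "t \<in> conformable_domain T" for c t
    using has_conformable_deriv_cmult[OF T that f] that by blast
  have mult: "has_conformable_deriv T \<alpha> (\<lambda>s. f s * g s) t
      (?D f t * g (forward_jump T t) + f t * ?D g t)"
    if "t \<in> conformable_domain T" "continuous_on T f" "continuous_on T g" for t
    using has_conformable_deriv_mult[OF T that(1) f g] that by blast
  \<comment> \<open>The other form of the product rule comes from exchanging the factors.\<close>
  have mult': "has_conformable_deriv T \<alpha> (\<lambda>s. f s * g s) t
      (?D f t * g t + f (forward_jump T t) * ?D g t)"
    if "t \<in> conformable_domain T" "continuous_on T f" "continuous_on T g" for t
    using has_conformable_deriv_mult[OF T that(1) g f] that by (simp add: mult.commute add.commute)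
  have recip: "has_conformable_deriv T \<alpha> (\<lambda>s. 1 / f s) t
      (- (?D f t / (f t * f (forward_jump T t))))"
    if "t \<in> conformable_domain T" "continuous_on T f" "f t * f (forward_jump T t) \<noteq> 0" for t
    using has_conformable_deriv_divide[OF T that(1) has_conformable_deriv_const[OF T that(1), of \<alpha> 1]
        f[OF that(1)] continuous_on_const that(2,3)] by simp
  have div: "has_conformable_deriv T \<alpha> (\<lambda>s. f s / g s) t
      ((?D f t * g t - f t * ?D g t) / (g t * g (forward_jump T t)))"
    if "t \<in> conformable_domain T" "continuous_on T f" "continuous_on T g"
      "g t * g (forward_jump T t) \<noteq> 0" for t
    using has_conformable_deriv_divide[OF T that(1) f g] that by blast
  show ?thesis
    unfolding conformable_differentiable_def
    by (intro conjI impI allI ballI)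
      (use add cmult mult mult' recip div in \<open>blast intro: ex conformable_deriv_eqI\<close>)+
qed

end
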